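(* Let $(X,d)$ be a complete metric space, let $\mathscr{G}$ be a generalized process in $X$ which is asymptotically backward autonomous for a quasi-invariant global selected pullback attractor $\mathcal{A}=\{\mathcal{A}(t)\}_{t\in\mathbb{R}}$ of $\mathscr{G}$, and let $\mathcal{A}_\infty$ be the global attractor of the corresponding autonomous problem. If $\mathcal{A}$ is backward compact, i.e., $\overline{\bigcup_{s\le t}\mathcal{A}(s)}$ is compact for all $t\in\mathbb{R}$, then $$\lim_{t\to-\infty}\mathrm{dist}(\mathcal{A}(t),\mathcal{A}_\infty)=0.$$
   Context: Let $(X,d)$ be a complete metric space. For nonempty $A,B\subset X$: $\mathrm{dist}(A,B)=\sup_{a\in A}\inf_{b\in B}d(a,b)$; for $\varepsilon>0$, $\mathcal{O}_\varepsilon(A)=\{z\in X:\inf_{a\in A}d(z,a)<\varepsilon\}$. Generalized process: a family $\mathscr{G}=\{\mathscr{G}(\tau)\}_{\tau\in\mathbb{R}}$ of sets $\mathscr{G}(\tau)$ consisting of functions $\varphi:[\tau,\infty)\to X$ (called solutions) such that: (C1) for each $\tau\in\mathbb{R}$ and $z\in X$ there is at least one $\varphi\in\mathscr{G}(\tau)$ with $\varphi(\tau)=z$; (C2) if $\varphi\in\mathscr{G}(\tau)$ and $s\ge 0$, then $\varphi|_{[\tau+s,\infty)}\in\mathscr{G}(\tau+s)$; (C3) if $\{\varphi_j\}_{j\in\mathbb{N}}\subset\mathscr{G}(\tau)$ and $\varphi_j(\tau)\to z$, then there are a subsequence $\{\varphi_{j_k}\}$ and $\varphi\in\mathscr{G}(\tau)$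 with $\varphi(\tau)=z$ and $\varphi_{j_k}(t)\to\varphi(t)$ as $k\to\infty$ for each $t\ge\tau$. A complete orbit (complete trajectory) through $x\in X$ at $\tau\in\mathbb{R}$ is a map $\psi:\mathbb{R}\to X$ with $\psi(\tau)=x$ and $\psi|_{[\tau+s,\infty)}\in\mathscr{G}(\tau+s)$ for all $s\in\mathbb{R}$. A family $\mathcal{A}=\{\mathcal{A}(t)\}_{t\in\mathbb{R}}$ of subsets of $X$ is quasi-invariant if for each $\tau\in\mathbb{R}$ and $z\in\mathcal{A}(\tau)$ there is a complete orbit $\psi$ through $z$ at $\tau$ with $\psi(t)\in\mathcal{A}(t)$ for all $t\in\mathbb{R}$. $\mathcal{A}$ select pullback attracts $x\in X$ at time $t\in\mathbb{R}$ if for every $\varepsilon>0$ there is $\tau_0\le t$ such that for all $\tau\le\tau_0$ there is $\varphi_\tau\in\mathscr{G}(\tau)$ with $\varphi_\tau(\tau)=x$ and $\varphi_\tau(t)\in\mathcal{O}_\varepsilon(\mathcal{A}(t))$. A global selected pullback attractor of $\mathscr{G}$ is a family of nonempty compact subsets $\mathcal{A}(t)$, $t\in\mathbb{R}$, of $X$ which select pullback attracts every $x\in X$ at every time $t\in\mathbb{R}$. Autonomous problem: it is given by a set $\mathcal{S}$ of functions $\varphi:[0,\infty)\to X$ (its solutions) such that every $z\in X$ is the initial value $\varphi(0)$ of some $\varphi\in\mathcal{S}$ and $\varphi(\cdot+s)\in\mathcal{S}$ for $\varphi\in\mathcal{S}$, $s\ge0$. Its multivalued semigroup is $G(t,B)=\{\varphi(t):\varphi\in\mathcal{S},\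 \varphi(0)\in B\}$, $t\ge 0$, $B\subset X$. Its global attractor $\mathcal{A}_\infty$ is a nonempty compact set with $\mathcal{A}_\infty\subset G(t,\mathcal{A}_\infty)$ for all $t\ge0$ and $\mathrm{dist}(G(t,B),\mathcal{A}_\infty)\to0$ as $t\to\infty$ for every nonempty bounded $B\subset X$. $\mathscr{G}$ is asymptotically backward autonomous for $\mathcal{A}$ (a quasi-invariant global selected pullback attractor), with corresponding autonomous problem $\mathcal{S}$, if: for every sequence of times $\tau\to-\infty$ and points $x_\tau\in\mathcal{A}(\tau)$ with $x_\tau\to x_0$ in $X$ as $\tau\to-\infty$, and all complete trajectories $\varphi_\tau$ with $\varphi_\tau(\tau)=x_\tau$ and $\varphi_\tau(s)\in\mathcal{A}(s)$ for all $s\in\mathbb{R}$, there is a solution $\varphi\in\mathcal{S}$ of the autonomous problem with $\varphi(0)=x_0$ and $\varphi_\tau(t+\tau)\to\varphi(t)$ as $\tau\to-\infty$ along the sequence, for each $t\ge0$. *)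

theory Defs
  imports "HOL-Analysis.Analysis"
begin

text \<open>
  The Hausdorff semidistance takes values in the extended reals because it may be infinite when
  the first set is unbounded; it is used for nonempty sets only.
\<close>

definition hausdorff_semidist :: "'a::metric_space set \<Rightarrow> 'a set \<Rightarrow> ereal" where
  "hausdorff_semidist A B = (SUP a\<in>A. ereal (infdist a B))"

text \<open>
  Only for nonempty \<open>A\<close>: the library sets \<^term>\<open>infdist z {} = 0\<close>.
\<close>

definition eps_nbhd :: "real \<Rightarrow> 'a::metric_space set \<Rightarrow> 'a set" where
  "eps_nbhd \<epsilon> A = {z. infdist z A < \<epsilon>}"

text \<open>
  A function \<open>[\<tau>, \<infinity>) \<rightarrow> X\<close> is an element of \<^term>\<open>extensional {\<tau>..}\<close>, i.e. a total function with
  the fixed value \<^term>\<open>undefined\<close> before \<open>\<tau>\<close>.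
\<close>

definition generalized_process :: "(real \<Rightarrow> (real \<Rightarrow> 'a::metric_space) set) \<Rightarrow> bool" where
  "generalized_process G \<longleftrightarrow>
     (\<forall>\<tau>. G \<tau> \<subseteq> extensional {\<tau>..}) \<and>
     (\<forall>\<tau> z. \<exists>\<phi>\<in>G \<tau>. \<phi> \<tau> = z) \<and>
     (\<forall>\<tau>. \<forall>\<phi>\<in>G \<tau>. \<forall>s\<ge>0. restrict \<phi> {\<tau> + s..} \<in> G (\<tau> + s)) \<and>
     (\<forall>\<tau> (\<Phi> :: nat \<Rightarrow> real \<Rightarrow> 'a) z.
        (\<forall>j. \<Phi> j \<in> G \<tau>) \<and> (\<lambda>j. \<Phi> j \<tau>) \<longlonglongrightarrow> z \<longrightarrow>
        (\<exists>(r :: nat \<Rightarrow> nat) \<phi>. strict_mono r \<and> \<phi> \<in> G \<tau> \<and> \<phi> \<tau> = z \<and>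
           (\<forall>t\<ge>\<tau>. (\<lambda>k. \<Phi> (r k) t) \<longlonglongrightarrow> \<phi> t)))"

definition complete_orbit ::
    "(real \<Rightarrow> (real \<Rightarrow> 'a::metric_space) set) \<Rightarrow> real \<Rightarrow> 'a \<Rightarrow> (real \<Rightarrow> 'a) \<Rightarrow> bool" where
  "complete_orbit G \<tau> x \<psi> \<longleftrightarrow>
     \<psi> \<tau> = x \<and> (\<forall>s. restrict \<psi> {\<tau> + s..} \<in> G (\<tau> + s))"

definition quasi_invariant ::
    "(real \<Rightarrow> (real \<Rightarrow> 'a::metric_space) set) \<Rightarrow> (real \<Rightarrow> 'a set) \<Rightarrow> bool" where
  "quasi_invariant G A \<longleftrightarrow>
     (\<forall>\<tau>. \<forall>z\<in>A \<tau>. \<exists>\<psi>. complete_orbit G \<tau> z \<psi> \<and> (\<forall>t. \<psi> t \<in> A t))"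

definition select_pullback_attracts ::
    "(real \<Rightarrow> (real \<Rightarrow> 'a::metric_space) set) \<Rightarrow> (real \<Rightarrow> 'a set) \<Rightarrow> 'a \<Rightarrow> real \<Rightarrow> bool" where
  "select_pullback_attracts G A x t \<longleftrightarrow>
     (\<forall>\<epsilon>>0. \<exists>\<tau>\<^sub>0\<le>t. \<forall>\<tau>\<le>\<tau>\<^sub>0. \<exists>\<phi>\<in>G \<tau>. \<phi> \<tau> = x \<and> \<phi> t \<in> eps_nbhd \<epsilon> (A t))"

definition global_selected_pullback_attractor ::
    "(real \<Rightarrow> (real \<Rightarrow> 'a::metric_space) set) \<Rightarrow> (real \<Rightarrow> 'a set) \<Rightarrow> bool" where
  "global_selected_pullback_attractor G A \<longleftrightarrow>
     (\<forall>t. A t \<noteq> {} \<and> compact (A t)) \<and>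
     (\<forall>x t. select_pullback_attracts G A x t)"

definition autonomous_problem :: "(real \<Rightarrow> 'a::metric_space) set \<Rightarrow> bool" where
  "autonomous_problem S \<longleftrightarrow>
     S \<subseteq> extensional {0..} \<and>
     (\<forall>z. \<exists>\<phi>\<in>S. \<phi> 0 = z) \<and>
     (\<forall>\<phi>\<in>S. \<forall>s\<ge>0. (\<lambda>t\<in>{0..}. \<phi> (t + s)) \<in> S)"

definition multivalued_semigroup ::
    "(real \<Rightarrow> 'a::metric_space) set \<Rightarrow> real \<Rightarrow> 'a set \<Rightarrow> 'a set" where
  "multivalued_semigroup S t B = {\<phi> t | \<phi>. \<phi> \<in> S \<and> \<phi> 0 \<in> B}"

definition global_attractor :: "(real \<Rightarrow> 'a::metric_space) set \<Rightarrow> 'a set \<Rightarrow> bool" where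
  "global_attractor S K \<longleftrightarrow>
     K \<noteq> {} \<and> compact K \<and>
     (\<forall>t\<ge>0. K \<subseteq> multivalued_semigroup S t K) \<and>
     (\<forall>B. B \<noteq> {} \<and> bounded B \<longrightarrow>
        ((\<lambda>t. hausdorff_semidist (multivalued_semigroup S t B) K) \<longlongrightarrow> 0) at_top)"

definition asymptotically_backward_autonomous ::
    "(real \<Rightarrow> (real \<Rightarrow> 'a::metric_space) set) \<Rightarrow> (real \<Rightarrow> 'a set) \<Rightarrow>
     (real \<Rightarrow> 'a) set \<Rightarrow> bool" where
  "asymptotically_backward_autonomous G A S \<longleftrightarrow>
     (\<forall>(\<tau> :: nat \<Rightarrow> real) (x :: nat \<Rightarrow> 'a) x\<^sub>0 (\<Psi> :: nat \<Rightarrow> real \<Rightarrow> 'a).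
        filterlim \<tau> at_bot sequentially \<and>
        (\<forall>n. x n \<in> A (\<tau> n)) \<and> x \<longlonglongrightarrow> x\<^sub>0 \<and>
        (\<forall>n. complete_orbit G (\<tau> n) (x n) (\<Psi> n) \<and> (\<forall>s. \<Psi> n s \<in> A s)) \<longrightarrow>
        (\<exists>\<phi>\<in>S. \<phi> 0 = x\<^sub>0 \<and> (\<forall>t\<ge>0. (\<lambda>n. \<Psi> n (t + \<tau> n)) \<longlonglongrightarrow> \<phi> t)))"

definition backward_compact :: "(real \<Rightarrow> 'a::metric_space set) \<Rightarrow> bool" where
  "backward_compact A \<longleftrightarrow> (\<forall>t. compact (closure (\<Union>s\<in>{..t}. A s)))"

end

theory Submission
  imports Defs
begin

text \<open>
  If the claim fails, there are points \<open>a\<^sub>n \<in> A (t\<^sub>n)\<close> with \<open>t\<^sub>n \<rightarrow> -\<infinity>\<close> that stay a distance \<open>\<epsilon>\<close>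
  away from the autonomous attractor. By backward compactness all early sections of \<open>A\<close> lie in one
  compact set \<open>B\<close>; take \<open>T\<close> so large that the autonomous semigroup maps \<open>B\<close> into the
  \<open>\<epsilon>\<close>-neighbourhood of its attractor at time \<open>T\<close>. Go back by \<open>T\<close> along complete orbits in \<open>A\<close>
  through \<open>a\<^sub>n\<close>: the points reached at time \<open>t\<^sub>n - T\<close> subconverge in \<open>B\<close>, so by backward autonomy
  \<open>a\<^sub>n\<close> subconverges to \<open>\<phi> T\<close> for some autonomous solution \<open>\<phi>\<close> starting in \<open>B\<close>, a contradiction.
\<close>

lemma hausdorff_semidist_leI:
  assumes "\<And>a. a \<in> A \<Longrightarrow> infdist a B \<le> e"
  shows "hausdorff_semidist A B \<le> ereal e"
  unfolding hausdorff_semidist_def using assms by (simp add: SUP_least)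

lemma infdist_le_hausdorff_semidist:
  assumes "a \<in> A"
  shows "ereal (infdist a B) \<le> hausdorff_semidist A B"
  unfolding hausdorff_semidist_def using assms by (rule SUP_upper)

text \<open>In \<open>ereal\<close> the supremum over an empty \<open>A\<close> would be minus
  infinity, hence the assumption.\<close>

lemma hausdorff_semidist_nonneg:
  assumes "A \<noteq> {}"
  shows "0 \<le> hausdorff_semidist A B"
proof -
  obtain a where "a \<in> A"
    using assms by blast
  then have "ereal (infdist a B) \<le> hausdorff_semidist A B"
    by (rule infdist_le_hausdorff_semidist)
  moreover have "0 \<le> ereal (infdist a B)"
    by (simp add: infdist_nonneg)
  ultimately show ?thesis
    by (rule order_trans[rotated])
qed

text \<open>The shift \<open>s\<close> ranges over all reals, negative ones included, so being a
  complete orbit does not depend on the base time.\<close>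

lemma complete_orbit_rebase:
  assumes "complete_orbit G \<tau> x \<psi>"
  shows "complete_orbit G \<sigma> (\<psi> \<sigma>) \<psi>"
proof -
  have "restrict \<psi> {\<sigma> + s..} \<in> G (\<sigma> + s)" for s
  proof -
    have "restrict \<psi> {\<tau> + (\<sigma> + s - \<tau>)..} \<in> G (\<tau> + (\<sigma> + s - \<tau>))"
      using assms unfolding complete_orbit_def by blast
    then show ?thesis
      by simp
  qed
  then show ?thesis
    by (simp add: complete_orbit_def)
qed

text \<open>
  The limit comes as \<open>\<phi> T\<close> for an autonomous solution \<open>\<phi>\<close> starting in the backward hull of \<open>A\<close>;
  \<open>T\<close> is prescribed in advance, which is what makes attraction of that hull usable.
\<close>

lemma backward_points_subconverge:
  fixes A :: "real \<Rightarrow> 'a::metric_space set"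
  assumes qi: "quasi_invariant G A"
    and aba: "asymptotically_backward_autonomous G A S"
    and comp: "compact (closure (\<Union>s\<in>{..u}. A s))"
    and "T \<ge> 0"
    and t: "filterlim t at_bot sequentially" "\<And>n. t n \<le> u"
    and a: "\<And>n. a n \<in> A (t n)"
  obtains r l where "strict_mono (r :: nat \<Rightarrow> nat)" "(\<lambda>n. a (r n)) \<longlonglongrightarrow> l"
    "l \<in> multivalued_semigroup S T (closure (\<Union>s\<in>{..u}. A s))"
proof -
  let ?B = "closure (\<Union>s\<in>{..u}. A s)"
  have "\<forall>n. \<exists>\<psi>. complete_orbit G (t n) (a n) \<psi> \<and> (\<forall>s. \<psi> s \<in> A s)"
    using qi a unfolding quasi_invariant_def by blast
  then obtain \<Psi> where \<Psi>: "\<And>n. complete_orbit G (t n) (a n) (\<Psi> n)" "\<And>n s. \<Psi> n s \<in> A s"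
    by metis
  have in_hull: "\<Psi> n (t n - T) \<in> ?B" for n
  proof -
    have "t n - T \<le> u"
      using t(2)[of n] \<open>T \<ge> 0\<close> by linarith
    then have "\<Psi> n (t n - T) \<in> (\<Union>s\<in>{..u}. A s)"
      using \<Psi>(2) by blast
    then show "\<Psi> n (t n - T) \<in> ?B"
      by (rule subsetD[OF closure_subset])
  qed
  obtain x r where x: "x \<in> ?B" "strict_mono (r :: nat \<Rightarrow> nat)"
    and lim: "((\<lambda>n. \<Psi> n (t n - T)) \<circ> r) \<longlonglongrightarrow> x"
    using in_hull
    by (rule seq_compactE[OF comp[unfolded compact_eq_seq_compact_metric], rule_format])
  \<comment> \<open>Rebased at these times, \<open>T\<close> before \<open>t (r n)\<close>, the
    orbits start from points converging to \<open>x\<close>, as backward autonomy requires.\<close>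
  define \<tau> where "\<tau> n = t (r n) - T" for n
  have "filterlim \<tau> at_bot sequentially"
    unfolding filterlim_at_bot
  proof
    fix Z
    have "filterlim (\<lambda>n. t (r n)) at_bot sequentially"
      using filterlim_compose[OF t(1) filterlim_subseq[OF x(2)]] .
    then have "eventually (\<lambda>n. t (r n) \<le> Z) sequentially"
      by (simp add: filterlim_at_bot)
    then show "eventually (\<lambda>n. \<tau> n \<le> Z) sequentially"
      by eventually_elim (use \<open>T \<ge> 0\<close> in \<open>simp add: \<tau>_def\<close>)
  qed
  moreover have "(\<lambda>n. \<Psi> (r n) (\<tau> n)) \<longlonglongrightarrow> x"
    using lim by (simp add: o_def \<tau>_def)
  moreover have "\<forall>n. \<Psi> (r n) (\<tau> n) \<in> A (\<tau> n)"
    using \<Psi>(2) by blast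
  moreover have "\<forall>n. complete_orbit G (\<tau> n) (\<Psi> (r n) (\<tau> n)) (\<Psi> (r n)) \<and> (\<forall>s. \<Psi> (r n) s \<in> A s)"
    using complete_orbit_rebase[OF \<Psi>(1)] \<Psi>(2) by blast
  ultimately have "\<exists>\<phi>\<in>S. \<phi> 0 = x \<and> (\<forall>s\<ge>0. (\<lambda>n. \<Psi> (r n) (s + \<tau> n)) \<longlonglongrightarrow> \<phi> s)"
    using aba[unfolded asymptotically_backward_autonomous_def, rule_format,
        of \<tau> "\<lambda>n. \<Psi> (r n) (\<tau> n)" x "\<lambda>n. \<Psi> (r n)"] by simp
  then obtain \<phi> where \<phi>: "\<phi> \<in> S" "\<phi> 0 = x" "(\<lambda>n. \<Psi> (r n) (T + \<tau> n)) \<longlonglongrightarrow> \<phi> T"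
    using \<open>T \<ge> 0\<close> by blast
  \<comment> \<open>After time \<open>T\<close> the orbit is back at time \<open>t (r n)\<close>,
    where it passes through \<open>a (r n)\<close>.\<close>
  have "\<Psi> (r n) (T + \<tau> n) = a (r n)" for n
    using \<Psi>(1)[of "r n"] by (simp add: complete_orbit_def \<tau>_def)
  with \<phi>(3) have "(\<lambda>n. a (r n)) \<longlonglongrightarrow> \<phi> T"
    by simp
  moreover have "\<phi> T \<in> multivalued_semigroup S T ?B"
    using \<phi> x(1) unfolding multivalued_semigroup_def by blast
  ultimately show ?thesis
    using that x(2) by blast
qed

theorem theorem18:
  fixes G :: "real \<Rightarrow> (real \<Rightarrow> 'a::complete_space) set"
    and A :: "real \<Rightarrow> 'a set"
    and S :: "(real \<Rightarrow> 'a) set"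
    and A_inf :: "'a set"
  assumes "generalized_process G"
    and "global_selected_pullback_attractor G A"
    and "quasi_invariant G A"
    and "autonomous_problem S"
    and "asymptotically_backward_autonomous G A S"
    and "global_attractor S A_inf"
    and "backward_compact A"
  shows "((\<lambda>t. hausdorff_semidist (A t) A_inf) \<longlongrightarrow> 0) at_bot"
proof (rule order_tendstoI)
  have nonempty: "A t \<noteq> {}" for t
    using assms(2) by (simp add: global_selected_pullback_attractor_def)
  fix y :: ereal
  {
    assume "y < 0"
    then have "y < hausdorff_semidist (A t) A_inf" for t
      using hausdorff_semidist_nonneg[OF nonempty, of t A_inf] by (rule less_le_trans)
    then show "eventually (\<lambda>t. y < hausdorff_semidist (A t) A_inf) at_bot"
      by simp
  }
  assume "0 < y"
  \<comment> \<open>The gap between \<open>e\<close> and \<open>y\<close> is needed because a bound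
    on each single distance bounds the supremum only non-strictly; \<open>y\<close> itself may be
    infinite.\<close>
  then obtain e where "0 < ereal e" "ereal e < y"
    using ereal_dense2 by blast
  let ?B = "closure (\<Union>s\<in>{..0}. A s)"
  have comp: "compact ?B"
    using assms(7) by (simp add: backward_compact_def)
  \<comment> \<open>Attraction is available for nonempty bounded sets only.\<close>
  obtain b where "b \<in> A 0"
    using nonempty by blast
  then have "b \<in> (\<Union>s\<in>{..0}. A s)"
    by (intro UN_I[of 0]) auto
  then have "?B \<noteq> {}"
    using closure_subset by blast
  then have "((\<lambda>T. hausdorff_semidist (multivalued_semigroup S T ?B) A_inf) \<longlongrightarrow> 0) at_top"
    using assms(6) compact_imp_bounded[OF comp] by (simp add: global_attractor_def)
  then have "eventually (\<lambda>T. hausdorff_semidist (multivalued_semigroup S T ?B) A_inf < ereal e) at_top"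
    using \<open>0 < ereal e\<close> by (rule order_tendstoD)
  then have "eventually (\<lambda>T. hausdorff_semidist (multivalued_semigroup S T ?B) A_inf < ereal e \<and> 0 \<le> T) at_top"
    using eventually_ge_at_top[of 0] by (rule eventually_conj)
  then obtain T where T: "hausdorff_semidist (multivalued_semigroup S T ?B) A_inf < ereal e" "0 \<le> T"
    using eventually_happens'[OF trivial_limit_at_top_linorder] by blast
  have "\<exists>t\<^sub>0. \<forall>t\<le>t\<^sub>0. \<forall>a\<in>A t. infdist a A_inf \<le> e"
  proof (rule ccontr)
    assume "\<not> ?thesis"
    then have "\<forall>n::nat. \<exists>t a. t \<le> - real n \<and> a \<in> A t \<and> \<not> infdist a A_inf \<le> e"
      by blast
    then obtain t a where t: "\<And>n::nat. t n \<le> - real n" and a: "\<And>n. a n \<in> A (t n)"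
      and far: "\<And>n. \<not> infdist (a n) A_inf \<le> e"
      by metis
    have t_bot: "filterlim t at_bot sequentially"
      unfolding filterlim_at_bot
    proof
      fix Z
      show "eventually (\<lambda>n. t n \<le> Z) sequentially"
        using eventually_ge_at_top[of "nat \<lceil>- Z\<rceil>"]
      proof eventually_elim
        case (elim n)
        then have "- Z \<le> real n"
          by linarith
        with t[of n] show "t n \<le> Z"
          by linarith
      qed
    qed
    have t_le: "t n \<le> 0" for n
      using t[of n] of_nat_0_le_iff[of n, where 'a = real] by linarith
    obtain r l where l: "(\<lambda>n. a (r n)) \<longlonglongrightarrow> l" "l \<in> multivalued_semigroup S T ?B"
      by (rule backward_points_subconverge[OF assms(3,5) comp T(2) t_bot t_le a])
    \<comment> \<open>The strict inequality in \<open>far\<close> becomes non-strict in the limit;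
      this suffices, since \<open>T\<close> was chosen with a strict bound.\<close>
    have "e \<le> infdist l A_inf"
      by (rule LIMSEQ_le_const[OF tendsto_infdist[OF l(1)]])
         (use far in \<open>auto simp: not_le intro: less_imp_le\<close>)
    then have "ereal e \<le> hausdorff_semidist (multivalued_semigroup S T ?B) A_inf"
      using infdist_le_hausdorff_semidist[OF l(2), of A_inf]
      by (meson ereal_less_eq(3) order_trans)
    with T(1) show False
      by simp
  qed
  then obtain t\<^sub>0 where "\<forall>t\<le>t\<^sub>0. \<forall>a\<in>A t. infdist a A_inf \<le> e"
    by blast
  then have "hausdorff_semidist (A t) A_inf < y" if "t \<le> t\<^sub>0" for t
    using that hausdorff_semidist_leI[of "A t" A_inf e] \<open>ereal e < y\<close> by (blast intro: le_less_trans)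
  then show "eventually (\<lambda>t. hausdorff_semidist (A t) A_inf < y) at_bot"
    unfolding eventually_at_bot_linorder by blast
qed

end
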